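(* For every integer $N\ge 2$, the map $T_N:(\mathbb{Z}/N\mathbb{Z})^2\to(\mathbb{Z}/N\mathbb{Z})^2$, $T_N(x)=Ax \bmod N$, where $A=\begin{pmatrix}1&1\\1&2\end{pmatrix}$, has exactly one fixed point, namely $x=0$. *)

theory Defs
  imports "HOL-Analysis.Analysis" "HOL-Number_Theory.Residues"
begin

definition cat_matrix :: "int ^ 2 ^ 2" where
  "cat_matrix = vector [vector [1, 1], vector [1, 2]]"

text \<open>The group \<open>(\<int>/N\<int>)\<^sup>2\<close>: integer vectors whose entries are the standard
  representatives \<open>0, \<dots>, N - 1\<close>, as in \<^const>\<open>residue_ring\<close>.\<close>

definition discrete_torus :: "int \<Rightarrow> (int ^ 2) set" where
  "discrete_torus N = {x. \<forall>i. x $ i \<in> carrier (residue_ring N)}"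

definition cat_map :: "int \<Rightarrow> int ^ 2 \<Rightarrow> int ^ 2" where
  "cat_map N x = (\<chi> i. (cat_matrix *v x) $ i mod N)"

end

theory Submission imports Defs begin

text \<open>A fixed point solves (A - I)x = 0 modulo \<open>N\<close>, where A - I has rows (0,1)
  and (1,1) and determinant -1, so it is invertible modulo every \<open>N\<close>. Concretely, the
  first row forces the second coordinate to vanish, and then the second row forces the first to
  vanish; \<open>cat_map_fixed_imp_zero\<close> carries this out on the standard
  representatives.\<close>

lemma cat_map_components:
  "cat_map N x $ 1 = (x $ 1 + x $ 2) mod N"
  "cat_map N x $ 2 = (x $ 1 + 2 * x $ 2) mod N"
  by (simp_all add: cat_map_def cat_matrix_def matrix_vector_mult_def sum_2)

lemma mem_discrete_torus_iff:
  "x \<in> discrete_torus N \<longleftrightarrow> (\<forall>i. 0 \<le> x $ i \<and> x $ i < N)"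
  by (auto simp: discrete_torus_def residue_ring_def)

lemma cat_map_fixed_imp_zero:
  assumes x: "x \<in> discrete_torus N" and fixed: "cat_map N x = x"
  shows "x = 0"
proof -
  have range: "0 \<le> x $ i" "x $ i < N" for i
    using x by (auto simp: mem_discrete_torus_iff)
  have fst: "(x $ 1 + x $ 2) mod N = x $ 1" and snd: "(x $ 1 + 2 * x $ 2) mod N = x $ 2"
    using fixed cat_map_components[of N x] by simp_all
  \<comment> \<open>Writing the reduced entry \<open>x $ 1\<close> as its own residue turns the
    equation into a congruence, so that \<open>x $ 1\<close> cancels.\<close>
  have "(x $ 1 + x $ 2) mod N = x $ 1 mod N"
    using fst range by simp
  then have "N dvd x $ 2"
    by (simp add: mod_eq_dvd_iff)
  \<comment> \<open>The only multiple of \<open>N\<close> among the representatives 0, ...,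
    \<open>N - 1\<close> is 0.\<close>
  then have "x $ 2 = 0"
    using range[of 2] by (simp add: dvd_eq_mod_eq_0)
  moreover from this have "x $ 1 = 0"
    using snd range[of 1] by simp
  ultimately show ?thesis
    by (simp add: vec_eq_iff forall_2)
qed

theorem theorem3p4:
  fixes N :: int
  assumes "N \<ge> 2"
  shows "cat_map N \<in> discrete_torus N \<rightarrow> discrete_torus N \<and>
         {x \<in> discrete_torus N. cat_map N x = x} = {0}"
proof
  show "cat_map N \<in> discrete_torus N \<rightarrow> discrete_torus N"
    using assms by (auto simp: mem_discrete_torus_iff cat_map_def)
  \<comment> \<open>Membership of 0 uses that \<open>N\<close> is positive.\<close>
  have "0 \<in> discrete_torus N" "cat_map N 0 = 0"
    using assms by (simp_all add: mem_discrete_torus_iff vec_eq_iff forall_2 cat_map_components)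
  then show "{x \<in> discrete_torus N. cat_map N x = x} = {0}"
    using cat_map_fixed_imp_zero by blast
qed

end
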